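(* Let $m\geq 4$ and let $g\in L^\infty_m(\mathbb{S}^1)$ be a solution of the steady problem \[ G\,\partial_\theta g=0,\qquad 4G+\partial_{\theta\theta}G=g . \] Then either $g$ is constant, or $g$ is piecewise constant with a finite number of jumps, and these jumps occur at the global maxima and minima of $\partial_\theta G$, which have exactly opposite non-zero values.
   Context: $\mathbb{S}^1=\mathbb{R}/2\pi\mathbb{Z}$. $L^\infty_m(\mathbb{S}^1)$ denotes bounded measurable $m$-fold symmetric functions, i.e. $g(\theta+2\pi/m)=g(\theta)$. For $m\ge 3$ the operator $4+\partial_{\theta\theta}$ is invertible on $m$-fold symmetric functions, so $G=(4+\partial_{\theta\theta})^{-1}g\in W^{2,\infty}$ is determined by $g$; the equation $G\partial_\theta g=0$ is understood in the sense of distributions, e.g. as $\partial_\theta(Gg)-(\partial_\theta G)g=0$. *)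

theory Defs
  imports "HOL-Analysis.Analysis"
begin

text \<open>Smooth 2pi-periodic test functions, i.e. test functions on the circle S^1 = R/2piZ.\<close>
definition smooth_periodic :: "(real \<Rightarrow> real) \<Rightarrow> bool" where
  "smooth_periodic \<phi> \<longleftrightarrow>
     (\<forall>n x. (deriv ^^ n) \<phi> differentiable (at x)) \<and> (\<forall>x. \<phi> (x + 2 * pi) = \<phi> x)"

definition ae_const_on :: "(real \<Rightarrow> real) \<Rightarrow> real \<Rightarrow> real \<Rightarrow> bool" where
  "ae_const_on g a b \<longleftrightarrow> (\<exists>c. AE x in lborel. x \<in> {a<..<b} \<longrightarrow> g x = c)"

end

theory Submission
  imports Defs
begin

text \<open>
  Put Q = G'^2 + 4 G^2, which is Lipschitz with derivative 2 G' g. The weak equation then says that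
  2 G g - Q has zero weak derivative, so 2 G g = Q - E almost everywhere for a constant E. Where
  G is nonzero, (Q - E) / (2 G) has derivative zero, so g is locally constant off the zeros of G;
  at a zero of G, Q = E and hence G'^2 = E.

  If G has a zero, m-fold symmetry bounds each component of its nonzero set by 2 pi / m, which is at
  most pi / 2. Testing G'' + 4 G = c on a component (a, b) against sin (2 (x - a)), which is
  nonnegative there, gives c G \<le> 0, so G'^2 + 4 G^2 \<le> E everywhere. Thus either G vanishes
  identically or E > 0; in the latter case the zeros of G are isolated and are exactly where the
  extreme values of G' can be attained, with both signs occurring at the two ends of a component.
\<close>

section \<open>Almost everywhere statements and integrals on the line\<close>

text \<open>\<open>Q\<close> is the energy of the free oscillator G'' + 4 G = 0. Under the forcing
  \<open>g\<close> it changes at rate 2 G' g, twice the term (G') g of the weak equation, so that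
  equation becomes a conservation law. The threshold pi / 2 is the half period of the same
  oscillator. The obstacle is regularity: \<open>g\<close> is only bounded and measurable, so G''
  exists merely as a density of the Lipschitz function \<open>deriv G\<close>, and the weak equation
  says nothing about single points. Identities are therefore carried as integrals over intervals,
  and pointwise facts are recovered from the continuity of \<open>Q\<close> and \<open>G\<close>.
  Trigonometric polynomials serve as test functions: their smoothness and periodicity follow by
  induction, and Stone-Weierstrass on the circle shows that there are enough of them. The jump set
  collects only those zeros of \<open>G\<close> near which \<open>g\<close> is not constant. A
  zero-free \<open>G\<close> is covered by the case of an empty jump set, where \<open>g\<close> is
  constant.\<close>

lemma integrable_on_bounded_borel:
  fixes f :: "real \<Rightarrow> real"
  assumes "f \<in> borel_measurable borel" "\<And>x. x \<in> {a..b} \<Longrightarrow> \<bar>f x\<bar> \<le> B"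
  shows "f integrable_on {a..b}"
proof (rule measurable_bounded_by_integrable_imp_integrable_real[of _ _ "\<lambda>_. B"])
  show "f \<in> borel_measurable (lebesgue_on {a..b})"
    using assms(1) by (intro measurable_restrict_space1 measurable_completion) simp
qed (use assms in auto)

lemma AE_zero_of_interval_integrals:
  fixes f :: "real \<Rightarrow> real"
  assumes [measurable]: "f \<in> borel_measurable borel" and bd: "\<And>x. \<bar>f x\<bar> \<le> B"
    and int0: "\<And>a b. a \<le> b \<Longrightarrow> integral {a..b} f = 0"
  shows "AE x in lborel. f x = 0"
proof -
  have B: "B \<ge> 0" using bd[of 0] by linarith
  \<comment> \<open>The nonnegative density h assigns every box its Lebesgue measure, so it equals 1 almost everywhere.\<close>
  define h where "h = (\<lambda>x. 1 + f x / (B + 1))"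
  have [measurable]: "h \<in> borel_measurable borel" unfolding h_def by measurable
  have h0: "h x \<ge> 0" for x
  proof -
    have "- f x \<le> B + 1" using bd[of x] by linarith
    then show ?thesis using B by (simp add: h_def field_simps)
  qed
  have "lborel = density lborel (\<lambda>x. ennreal (h x))"
  proof (rule lborel_eqI)
    fix l u :: real assume "\<And>b. b \<in> Basis \<Longrightarrow> l \<bullet> b \<le> u \<bullet> b"
    then have lu: "l \<le> u" by auto
    have "f integrable_on {l..u}" by (rule integrable_on_bounded_borel) (use bd in auto)
    then have "(f has_integral 0) {l..u}" using int0[OF lu] by (simp add: has_integral_iff)
    then have "((\<lambda>x. 1 + f x / (B + 1)) has_integral (u - l) + 0 / (B + 1)) {l..u}"
      using lu has_integral_const_real[of "1::real" l u]
      by (intro has_integral_add has_integral_divide) (auto simp: content_real)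
    then have "(h has_integral (u - l)) (box l u)"
      by (simp add: h_def has_integral_Icc_iff_Ioo box_real)
    then have *: "((\<lambda>x. if x \<in> box l u then h x else 0) has_integral (u - l)) UNIV"
      by (subst has_integral_restrict_UNIV)
    have "emeasure (density lborel (\<lambda>x. ennreal (h x))) (box l u)
        = (\<integral>\<^sup>+ x. ennreal (h x) * indicator (box l u) x \<partial>lborel)"
      by (rule emeasure_density) auto
    also have "\<dots> = (\<integral>\<^sup>+ x. ennreal (if x \<in> box l u then h x else 0) \<partial>lborel)"
      by (intro nn_integral_cong) (auto simp: indicator_def)
    also have "\<dots> = ennreal (u - l)"
      by (rule nn_integral_has_integral_lborel[OF _ _ *]) (use h0 in auto)
    finally show "emeasure (density lborel (\<lambda>x. ennreal (h x))) (box l u)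
        = ennreal (\<Prod>b\<in>Basis. (u - l) \<bullet> b)" by simp
  qed simp
  then have "density lborel (\<lambda>x. ennreal (h x)) = density lborel (\<lambda>_::real. 1)"
    by (simp add: density_1)
  then have "AE x in lborel. ennreal (h x) = 1"
    by (intro sigma_finite_measure.density_unique[OF sigma_finite_lborel]) auto
  then show ?thesis
  proof eventually_elim
    case (elim x)
    then show ?case using B by (simp add: h_def)
  qed
qed

lemma AE_lborel_shift:
  fixes P :: "real \<Rightarrow> bool"
  assumes "{x. P x} \<in> sets borel" "AE x in lborel. P x"
  shows "AE x in lborel. P (c + x)"
  using assms AE_distr_iff[of "(+) c" lborel borel P] unfolding lborel_distr_plus by simp

text \<open>The set of violations is open, and a nonempty open set has positive measure. This
  transfers almost everywhere bounds to individual points, in particular to the zeros of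
  \<open>G\<close>.\<close>

lemma continuous_le_of_AE_le:
  fixes u v :: "real \<Rightarrow> real"
  assumes "continuous_on UNIV u" "continuous_on UNIV v" "AE x in lborel. u x \<le> v x"
  shows "u x \<le> v x"
proof (rule ccontr)
  assume "\<not> u x \<le> v x"
  define U where "U = {x. v x < u x}"
  have "open U" unfolding U_def by (intro open_Collect_less assms)
  moreover have "x \<in> U" using \<open>\<not> u x \<le> v x\<close> by (simp add: U_def)
  ultimately obtain e where e: "e > 0" "ball x e \<subseteq> U" by (meson open_contains_ball)
  have "AE y in lborel. y \<notin> U" using assms(3) by eventually_elim (auto simp: U_def)
  then have "emeasure lborel U = 0"
    using \<open>open U\<close> by (subst AE_iff_measurable[symmetric, where P = "\<lambda>y. y \<notin> U"]) auto
  then have "emeasure lborel (ball x e) = 0" 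
    using e \<open>open U\<close> by (metis emeasure_mono le_zero_eq sets_lborel borel_open)
  then show False using e(1) by (simp add: ball_eq_greaterThanLessThan)
qed

text \<open>A center \<open>z\<close> inside the ball of \<open>x\<close> forces the two constants
  to agree, because the overlap of the balls has positive measure. So the local value
  \<open>v\<close> is locally constant, hence constant on the connected set. Lindelof then leaves
  countably many balls, whose exceptional null sets have a null union.\<close>

lemma AE_const_of_locally_AE_const:
  fixes g :: "real \<Rightarrow> 'a"
  assumes S: "open S" "connected S"
    and loc: "\<And>x. x \<in> S \<Longrightarrow> \<exists>e>0. \<exists>c. AE y in lborel. y \<in> ball x e \<longrightarrow> g y = c"
  shows "\<exists>c. AE y in lborel. y \<in> S \<longrightarrow> g y = c"
proof -
  obtain e v where ev: "\<And>x. x \<in> S \<Longrightarrow> e x > 0 \<and> (AE y in lborel. y \<in> ball x (e x) \<longrightarrow> g y = v x)"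
    using loc by metis
  have val: "v x = v z" if "x \<in> S" "z \<in> S" "z \<in> ball x (e x)" for x z
  proof (rule ccontr)
    assume ne: "v x \<noteq> v z"
    have "open (ball x (e x) \<inter> ball z (e z))" by auto
    moreover have "z \<in> ball x (e x) \<inter> ball z (e z)" using that ev by auto
    ultimately obtain d where d: "d > 0" "ball z d \<subseteq> ball x (e x) \<inter> ball z (e z)"
      by (meson open_contains_ball)
    have "AE y in lborel. y \<in> ball x (e x) \<longrightarrow> g y = v x" "AE y in lborel. y \<in> ball z (e z) \<longrightarrow> g y = v z"
      using ev that by auto
    then have "AE y in lborel. y \<notin> ball z d"
      by eventually_elim (use ne d in auto)
    then have "emeasure lborel (ball z d) = 0"
      by (subst AE_iff_measurable[symmetric, where P = "\<lambda>y. y \<notin> ball z d"]) auto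
    then show False using d(1) by (simp add: ball_eq_greaterThanLessThan)
  qed
  have const: "v x = v z" if "x \<in> S" "z \<in> S" for x z
  proof (rule connected_local_const[OF S(2) that], rule ballI)
    fix a assume a: "a \<in> S"
    then have "eventually (\<lambda>b. b \<in> ball a (e a)) (at a within S)"
      using ev by (intro eventually_at_topological[THEN iffD2]) (metis centre_in_ball open_ball)
    moreover have "eventually (\<lambda>b. b \<in> S) (at a within S)" by (simp add: eventually_at_filter)
    ultimately show "eventually (\<lambda>b. v a = v b) (at a within S)"
      by eventually_elim (use val a in auto)
  qed
  show ?thesis
  proof (cases "S = {}")
    case False
    then obtain x0 where x0: "x0 \<in> S" by auto
    obtain F where F: "F \<subseteq> (\<lambda>x. ball x (e x)) ` S" "countable F" "\<Union>F = (\<Union>x\<in>S. ball x (e x))"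
      using Lindelof[of "(\<lambda>x. ball x (e x)) ` S"] by (metis imageE open_ball)
    have "AE y in lborel. \<forall>B\<in>F. y \<in> B \<longrightarrow> g y = v x0"
    proof (subst AE_ball_countable[OF F(2)], rule ballI)
      fix B assume "B \<in> F"
      then obtain x where x: "x \<in> S" "B = ball x (e x)" using F(1) by auto
      show "AE y in lborel. y \<in> B \<longrightarrow> g y = v x0"
        using ev[OF x(1)] const[OF x0 x(1)] x(2) by simp
    qed
    then have "AE y in lborel. y \<in> S \<longrightarrow> g y = v x0"
    proof eventually_elim
      case (elim y)
      then show ?case using F(3) ev by (metis UN_I Union_iff centre_in_ball)
    qed
    then show ?thesis by blast
  qed simp
qed

text \<open>
  No almost everywhere differentiation is needed: the defect D of the product rule satisfies
  |D y - D x| \<le> 2 B^2 (y - x)^2, so its derivative vanishes everywhere.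
\<close>
lemma product_rule_integral:
  fixes P R p r :: "real \<Rightarrow> real"
  assumes p: "\<And>x y. x \<le> y \<Longrightarrow> (p has_integral (P y - P x)) {x..y}"
    and r: "\<And>x y. x \<le> y \<Longrightarrow> (r has_integral (R y - R x)) {x..y}"
    and pb: "\<And>x. \<bar>p x\<bar> \<le> B" and rb: "\<And>x. \<bar>r x\<bar> \<le> B"
    and int: "\<And>x y. (\<lambda>t. p t * R t + P t * r t) integrable_on {x..y}"
    and ab: "a \<le> b"
  shows "((\<lambda>t. p t * R t + P t * r t) has_integral (P b * R b - P a * R a)) {a..b}"
proof -
  have B: "B \<ge> 0" using pb[of 0] by linarith
  define D where "D x = P x * R x - integral {a..x} (\<lambda>t. p t * R t + P t * r t)" for x
  have lip: "\<bar>F y - F x\<bar> \<le> B * (y - x)" 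
    if F: "\<And>x y. x \<le> y \<Longrightarrow> (f has_integral (F y - F x)) {x..y}" "\<And>x. \<bar>f x\<bar> \<le> B" "x \<le> y" for F f x y
    using has_integral_bound_real[OF B finite.emptyI F(1)[OF F(3)]] F(2,3) by auto
  have incr: "\<bar>D y - D x\<bar> \<le> 2 * B\<^sup>2 * (y - x)\<^sup>2" if xy: "a \<le> x" "x \<le> y" for x y
  proof -
    have i: "((\<lambda>t. p t * R t + P t * r t) has_integral
        (integral {a..y} (\<lambda>t. p t * R t + P t * r t) - integral {a..x} (\<lambda>t. p t * R t + P t * r t))) {x..y}"
      using Henstock_Kurzweil_Integration.integral_combine[OF xy int] int[of x y]
      by (simp add: has_integral_iff)
    \<comment> \<open>Freezing \<open>R\<close> at the right end and \<open>P\<close> at the left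
      end makes the integral exactly \<open>P y * R y - P x * R x\<close>. The defect is then the
      integral of terms each containing an increment of \<open>R\<close> or \<open>P\<close>, of
      size at most \<open>B * (y - x)\<close>; the length of the interval supplies the second factor
      \<open>y - x\<close>.\<close>
    have "((\<lambda>t. p t * R y + P x * r t) has_integral ((P y - P x) * R y + P x * (R y - R x))) {x..y}"
      by (intro has_integral_add has_integral_mult_left has_integral_mult_right p r xy)
    from has_integral_diff[OF this i]
    have "((\<lambda>t. p t * (R y - R t) + (P x - P t) * r t) has_integral (D y - D x)) {x..y}"
      by (simp add: D_def algebra_simps)
    moreover have "norm (p t * (R y - R t) + (P x - P t) * r t) \<le> 2 * B\<^sup>2 * (y - x)" if "t \<in> {x..y}" for t
    proof -
      have t: "x \<le> t" "t \<le> y" using that by auto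
      have "\<bar>R y - R t\<bar> \<le> B * (y - x)" 
        using lip[OF r rb t(2)] mult_left_mono[OF _ B, of "y - t" "y - x"] t by linarith
      moreover have "\<bar>P x - P t\<bar> \<le> B * (y - x)" 
        using lip[OF p pb t(1)] mult_left_mono[OF _ B, of "t - x" "y - x"] t by linarith
      ultimately have "\<bar>p t\<bar> * \<bar>R y - R t\<bar> \<le> B * (B * (y - x))" "\<bar>P x - P t\<bar> * \<bar>r t\<bar> \<le> (B * (y - x)) * B"
        using pb[of t] rb[of t] B xy(2) by (auto intro!: mult_mono)
      then have "\<bar>p t * (R y - R t)\<bar> + \<bar>(P x - P t) * r t\<bar> \<le> 2 * B\<^sup>2 * (y - x)"
        unfolding abs_mult by (simp add: power2_eq_square algebra_simps)
      then show ?thesis using abs_triangle_ineq[of "p t * (R y - R t)" "(P x - P t) * r t"] by simp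
    qed
    ultimately have "norm (D y - D x) \<le> 2 * B\<^sup>2 * (y - x) * measure lborel {x..y}"
      using xy B by (intro has_integral_bound_real[of _ "{}"]) auto
    then show ?thesis using xy by (simp add: power2_eq_square content_real mult.assoc)
  qed
  have "\<exists>c. \<forall>x\<in>{a..b}. D x = c"
  proof (rule has_field_derivative_zero_constant)
    fix x assume x: "x \<in> {a..b}"
    have q: "\<bar>(D y - D x) / (y - x)\<bar> \<le> 2 * B\<^sup>2 * \<bar>y - x\<bar>" if "y \<in> {a..b}" "y \<noteq> x" for y
    proof -
      have "\<bar>D y - D x\<bar> \<le> 2 * B\<^sup>2 * (y - x)\<^sup>2"
        using incr[of x y] incr[of y x] x that by (cases "x \<le> y") (auto simp: abs_minus_commute power2_commute)
      then have "\<bar>D y - D x\<bar> \<le> (2 * B\<^sup>2 * \<bar>y - x\<bar>) * \<bar>y - x\<bar>"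
        by (simp add: power2_eq_square mult.assoc flip: abs_mult)
      then show ?thesis using that by (simp add: abs_divide divide_le_eq)
    qed
    have "((\<lambda>y. (D y - D x) / (y - x)) \<longlongrightarrow> 0) (at x within {a..b})"
    proof (rule Lim_null_comparison)
      show "\<forall>\<^sub>F y in at x within {a..b}. norm ((D y - D x) / (y - x)) \<le> 2 * B\<^sup>2 * \<bar>y - x\<bar>"
        unfolding eventually_at_filter using q by (auto intro!: always_eventually)
      show "((\<lambda>y. 2 * B\<^sup>2 * \<bar>y - x\<bar>) \<longlongrightarrow> 0) (at x within {a..b})"
        by (auto intro!: tendsto_eq_intros)
    qed
    then show "(D has_field_derivative 0) (at x within {a..b})"
      by (simp add: has_field_derivative_iff)
  qed simp
  then have "D b = D a" using ab by auto
  then show ?thesis using int[of a b] by (simp add: D_def has_integral_iff)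
qed

section \<open>Trigonometric polynomials as test functions\<close>

text \<open>The span of the Fourier modes, given inductively so that its closure properties are
  proved by induction. Integer frequencies keep it closed under the product-to-sum formulas, which
  produce \<open>k - l\<close>; frequency 0 provides the constants.\<close>

inductive trig_poly :: "(real \<Rightarrow> real) \<Rightarrow> bool" where
  cos: "trig_poly (\<lambda>x. cos (of_int k * x))"
| sin: "trig_poly (\<lambda>x. sin (of_int k * x))"
| scale: "trig_poly p \<Longrightarrow> trig_poly (\<lambda>x. c * p x)"
| add: "trig_poly p \<Longrightarrow> trig_poly q \<Longrightarrow> trig_poly (\<lambda>x. p x + q x)"

lemma trig_poly_const: "trig_poly (\<lambda>x. c)"
  using trig_poly.scale[OF trig_poly.cos[of 0], of c] by simp

lemma trig_poly_mult_mode: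
  assumes "trig_poly q"
  shows "trig_poly (\<lambda>x. cos (of_int k * x) * q x) \<and> trig_poly (\<lambda>x. sin (of_int k * x) * q x)"
  using assms
proof induction
  case (cos l)
  have "(\<lambda>x::real. cos (of_int k * x) * cos (of_int l * x)) =
      (\<lambda>x. 1/2 * cos (of_int (k - l) * x) + 1/2 * cos (of_int (k + l) * x))"
    by (auto simp: fun_eq_iff cos_times_cos distrib_right left_diff_distrib add_divide_distrib)
  moreover have "(\<lambda>x::real. sin (of_int k * x) * cos (of_int l * x)) =
      (\<lambda>x. 1/2 * sin (of_int (k + l) * x) + 1/2 * sin (of_int (k - l) * x))"
    by (auto simp: fun_eq_iff sin_times_cos distrib_right left_diff_distrib add_divide_distrib)
  ultimately show ?case by (simp only:) (intro conjI trig_poly.intros)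
next
  case (sin l)
  have "(\<lambda>x::real. cos (of_int k * x) * sin (of_int l * x)) =
      (\<lambda>x. 1/2 * sin (of_int (k + l) * x) + (-1/2) * sin (of_int (k - l) * x))"
    by (auto simp: fun_eq_iff cos_times_sin distrib_right left_diff_distrib diff_divide_distrib)
  moreover have "(\<lambda>x::real. sin (of_int k * x) * sin (of_int l * x)) =
      (\<lambda>x. 1/2 * cos (of_int (k - l) * x) + (-1/2) * cos (of_int (k + l) * x))"
    by (auto simp: fun_eq_iff sin_times_sin distrib_right left_diff_distrib diff_divide_distrib)
  ultimately show ?case by (simp only:) (intro conjI trig_poly.intros)
next
  case (scale p c)
  then show ?case
    using trig_poly.scale[of "\<lambda>x. cos (of_int k * x) * p x" c] trig_poly.scale[of "\<lambda>x. sin (of_int k * x) * p x" c]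
    by (simp add: mult.left_commute)
next
  case (add p q)
  then show ?case by (simp add: distrib_left trig_poly.add)
qed

lemma trig_poly_mult:
  assumes "trig_poly p" "trig_poly q"
  shows "trig_poly (\<lambda>x. p x * q x)"
  using assms(1)
proof induction
  case (scale p c)
  then show ?case using trig_poly.scale[of "\<lambda>x. p x * q x" c] by (simp add: mult.assoc)
next
  case (add p r)
  then show ?case by (simp add: distrib_right trig_poly.add)
qed (use trig_poly_mult_mode[OF assms(2)] in auto)

lemma trig_poly_has_derivative:
  assumes "trig_poly p"
  shows "\<exists>q. trig_poly q \<and> (\<forall>x. (p has_real_derivative q x) (at x))"
  using assms
proof induction
  case (cos k)
  show ?case
    by (intro exI[of _ "\<lambda>x. (- of_int k) * sin (of_int k * x)"] conjI trig_poly.intros)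
       (auto intro!: derivative_eq_intros)
next
  case (sin k)
  show ?case
    by (intro exI[of _ "\<lambda>x. of_int k * cos (of_int k * x)"] conjI trig_poly.intros)
       (auto intro!: derivative_eq_intros)
next
  case (scale p c)
  then obtain q where q: "trig_poly q" "\<And>x. (p has_real_derivative q x) (at x)" by blast
  then show ?case
    by (intro exI[of _ "\<lambda>x. c * q x"] conjI trig_poly.scale) (auto intro!: derivative_eq_intros)
next
  case (add p r)
  then obtain q s where q: "trig_poly q" "\<And>x. (p has_real_derivative q x) (at x)"
    and s: "trig_poly s" "\<And>x. (r has_real_derivative s x) (at x)" by blast
  then show ?case
    by (intro exI[of _ "\<lambda>x. q x + s x"] conjI trig_poly.add) (auto intro!: derivative_eq_intros)
qed

text \<open>Only frequency 0 lacks a periodic antiderivative; \<open>c\<close> collects its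
  coefficient, that is, the mean of \<open>p\<close> over a period.\<close>

lemma trig_poly_has_antiderivative:
  assumes "trig_poly p"
  shows "\<exists>q c. trig_poly q \<and> (\<forall>x. (q has_real_derivative p x - c) (at x))"
  using assms
proof induction
  case (cos k)
  show ?case
  proof (cases "k = 0")
    case True
    then show ?thesis
      by (intro exI[of _ "\<lambda>x. 0"] exI[of _ 1] conjI trig_poly_const) auto
  next
    case False
    then show ?thesis
      by (intro exI[of _ "\<lambda>x. (1 / of_int k) * sin (of_int k * x)"] exI[of _ 0] conjI trig_poly.intros)
         (auto intro!: derivative_eq_intros)
  qed
next
  case (sin k)
  show ?case
  proof (cases "k = 0")
    case True
    then show ?thesis
      by (intro exI[of _ "\<lambda>x. 0"] exI[of _ 0] conjI trig_poly_const) auto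
  next
    case False
    then show ?thesis
      by (intro exI[of _ "\<lambda>x. (- 1 / of_int k) * cos (of_int k * x)"] exI[of _ 0] conjI trig_poly.intros)
         (auto intro!: derivative_eq_intros)
  qed
next
  case (scale p c)
  then obtain q d where q: "trig_poly q" "\<And>x. (q has_real_derivative p x - d) (at x)" by blast
  then show ?case
    by (intro exI[of _ "\<lambda>x. c * q x"] exI[of _ "c * d"] conjI trig_poly.scale)
       (auto intro!: derivative_eq_intros simp: algebra_simps)
next
  case (add p r)
  then obtain q d s e where q: "trig_poly q" "\<And>x. (q has_real_derivative p x - d) (at x)"
    and s: "trig_poly s" "\<And>x. (s has_real_derivative r x - e) (at x)" by blast
  then show ?case
    by (intro exI[of _ "\<lambda>x. q x + s x"] exI[of _ "d + e"] conjI trig_poly.add)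
       (auto intro!: derivative_eq_intros)
qed

lemma trig_poly_periodic:
  assumes "trig_poly p"
  shows "p (x + 2 * pi) = p x"
  using assms
proof induction
  case (cos k)
  have "cos (of_int k * x + 2 * pi * of_int k) = cos (of_int k * x)"
    unfolding cos_add by (simp only: cos_int_2pin sin_int_2pin mult_1_right mult_zero_right diff_zero)
  then show ?case by (simp add: algebra_simps)
next
  case (sin k)
  have "sin (of_int k * x + 2 * pi * of_int k) = sin (of_int k * x)"
    unfolding sin_add by (simp only: cos_int_2pin sin_int_2pin mult_1_right mult_zero_right add_0_right)
  then show ?case by (simp add: algebra_simps)
qed auto

lemma continuous_on_trig_poly: "trig_poly p \<Longrightarrow> continuous_on S p"
  by (induction rule: trig_poly.induct) (auto intro!: continuous_intros)

lemma smooth_periodic_trig_poly: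
  assumes "trig_poly p"
  shows "smooth_periodic p"
proof -
  have d: "trig_poly (deriv q)" "q differentiable (at x)" if q: "trig_poly q" for q x
  proof -
    obtain r where r: "trig_poly r" "\<And>x. (q has_real_derivative r x) (at x)"
      using trig_poly_has_derivative[OF q] by blast
    then have "deriv q = r" by (auto intro: DERIV_imp_deriv)
    then show "trig_poly (deriv q)" using r(1) by simp
    show "q differentiable (at x)" using r(2) real_differentiable_def by blast
  qed
  have "trig_poly ((deriv ^^ n) p)" for n
    by (induction n) (use assms d in auto)
  then show ?thesis
    unfolding smooth_periodic_def using d trig_poly_periodic[OF assms] by auto
qed

text \<open>Polynomial functions on the plane, as delivered by Stone-Weierstrass on the unit circle,
  pull back to test functions: a linear functional becomes a combination of cosine and sine, and
  sums and products stay in the class.\<close>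

lemma trig_poly_of_polynomial_cis:
  fixes P :: "complex \<Rightarrow> real"
  assumes "real_polynomial_function P"
  shows "trig_poly (\<lambda>x. P (cis x))"
  using assms
proof induction
  case (linear f)
  then interpret bounded_linear f .
  have "cis x = cos x *\<^sub>R 1 + sin x *\<^sub>R \<i>" for x by (simp add: complex_eq_iff)
  then have "f (cis x) = f 1 * cos (of_int 1 * x) + f \<i> * sin (of_int 1 * x)" for x
    by (simp add: add scaleR)
  then show ?case by (simp only:) (intro trig_poly.intros)
qed (auto intro: trig_poly_const trig_poly.add trig_poly_mult)

text \<open>Orthogonality is extended from trigonometric polynomials to continuous functions on the
  circle by uniform approximation, and from these to indicators of intervals by dominated
  convergence; vanishing interval integrals then give the claim.\<close>

lemma AE_zero_of_orthogonal_trig_poly: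
  fixes f :: "real \<Rightarrow> real"
  assumes meas [measurable]: "f \<in> borel_measurable borel" and bd: "\<And>x. \<bar>f x\<bar> \<le> B"
    and orth: "\<And>p. trig_poly p \<Longrightarrow> integral {0..2 * pi} (\<lambda>x. f x * p x) = 0"
  shows "AE x in lborel. x \<in> {0..2 * pi} \<longrightarrow> f x = 0"
proof -
  have B: "B \<ge> 0" using bd[of 0] by linarith
  have int: "(\<lambda>x. f x * w x) integrable_on {0..2 * pi}" 
    if "continuous_on UNIV w" for w :: "real \<Rightarrow> real"
  proof -
    have [measurable]: "w \<in> borel_measurable borel" 
      by (rule borel_measurable_continuous_onI[OF that])
    have "compact (w ` {0..2 * pi})"
      using that continuous_on_subset by (intro compact_continuous_image) auto
    then obtain W where W: "\<And>x. x \<in> {0..2 * pi} \<Longrightarrow> \<bar>w x\<bar> \<le> W"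
      by (meson compact_imp_bounded bounded_real imageI)
    show ?thesis
    proof (rule integrable_on_bounded_borel)
      show "\<bar>f x * w x\<bar> \<le> B * W" if "x \<in> {0..2 * pi}" for x
        using bd[of x] W[OF that] B by (simp add: abs_mult mult_mono)
    qed measurable
  qed
  have cont_cis: "continuous_on UNIV (\<lambda>x. u (cis x))" if "continuous_on UNIV u" for u :: "complex \<Rightarrow> real"
    by (rule continuous_on_compose2[OF that]) (auto intro!: continuous_intros)
  have cont0: "integral {0..2 * pi} (\<lambda>x. f x * u (cis x)) = 0"
    if u: "continuous_on UNIV u" for u :: "complex \<Rightarrow> real"
  proof -
    have "\<bar>integral {0..2 * pi} (\<lambda>x. f x * u (cis x))\<bar> \<le> 0 + e" if "e > 0" for e
    proof -
      \<comment> \<open>An error \<open>d\<close> in the test function costs at most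
        \<open>2 * pi * B * d = e * (B / (B + 1))\<close>, which is at most \<open>e\<close>; the
        \<open>+ 1\<close> covers \<open>B = 0\<close>.\<close>
      define d where "d = e / (2 * pi * (B + 1))"
      have d: "d > 0" using that B by (simp add: d_def)
      obtain P where P: "real_polynomial_function P" "\<And>z. z \<in> sphere 0 1 \<Longrightarrow> \<bar>u z - P z\<bar> < d"
        using Stone_Weierstrass_real_polynomial_function[of "sphere 0 1" u d] d u
        by (metis compact_sphere continuous_on_subset subset_UNIV)
      have p: "trig_poly (\<lambda>x. P (cis x))" by (rule trig_poly_of_polynomial_cis[OF P(1)])
      have i: "(\<lambda>x. f x * u (cis x)) integrable_on {0..2 * pi}" 
              "(\<lambda>x. f x * P (cis x)) integrable_on {0..2 * pi}"
        by (rule int, rule cont_cis[OF u], rule int, rule continuous_on_trig_poly[OF p])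
      have "integral {0..2 * pi} (\<lambda>x. f x * u (cis x)) =
          integral {0..2 * pi} (\<lambda>x. f x * u (cis x) - f x * P (cis x))"
        using Henstock_Kurzweil_Integration.integral_diff[OF i] orth[OF p] by simp
      also have "norm \<dots> \<le> integral {0..2 * pi} (\<lambda>x. B * d)"
      proof (rule Henstock_Kurzweil_Integration.integral_norm_bound_integral)
        show "(\<lambda>x. f x * u (cis x) - f x * P (cis x)) integrable_on {0..2 * pi}"
          by (intro Henstock_Kurzweil_Integration.integrable_diff i)
        fix x
        have "\<bar>f x\<bar> * \<bar>u (cis x) - P (cis x)\<bar> \<le> B * d"
          using bd[of x] P(2)[of "cis x"] B by (intro mult_mono) auto
        then show "norm (f x * u (cis x) - f x * P (cis x)) \<le> B * d"
          by (simp add: abs_mult flip: right_diff_distrib)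
      qed auto
      also have "\<dots> = e * (B / (B + 1))" using B by (simp add: d_def)
      also have "\<dots> \<le> e * 1" using that B by (intro mult_left_mono) auto
      finally show ?thesis by simp
    qed
    then have "\<bar>integral {0..2 * pi} (\<lambda>x. f x * u (cis x))\<bar> \<le> 0" by (rule field_le_epsilon)
    then show ?thesis by simp
  qed
  have ivl: "integral {0..2 * pi} (\<lambda>x. f x * indicator ({a<..<b} \<inter> {0<..<2 * pi}) x) = 0" for a b :: real
  proof -
    \<comment> \<open>The point 1 is the common image of 0 and \<open>2 * pi\<close>. Putting it
      into \<open>K\<close> makes the complement of \<open>K\<close> pull back exactly to the open
      interval inside the period, and keeps \<open>K\<close> nonempty, as the distance to
      \<open>K\<close> requires.\<close>
    define K where "K = insert 1 (cis ` ({0..2 * pi} - {a<..<b}))"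
    have "compact K" unfolding K_def
      by (intro compact_insert compact_continuous_image compact_diff) (auto intro!: continuous_intros)
    then have K: "closed K" "K \<noteq> {}" by (auto simp: compact_imp_closed K_def)
    have inK: "cis x \<in> K \<longleftrightarrow> x \<notin> {a<..<b} \<inter> {0<..<2 * pi}" if x: "x \<in> {0..2 * pi}" for x
    proof
      assume "cis x \<in> K"
      show "x \<notin> {a<..<b} \<inter> {0<..<2 * pi}"
      proof
        assume xI: "x \<in> {a<..<b} \<inter> {0<..<2 * pi}"
        obtain y where y: "cis x = cis y" "y \<in> {0..2 * pi}" "y \<noteq> x"
        proof (cases "cis x = 1")
          case True
          then show thesis using that[of 0] xI by auto
        next
          case False
          then obtain y where "cis x = cis y" "y \<in> {0..2 * pi} - {a<..<b}"
            using \<open>cis x \<in> K\<close> unfolding K_def by auto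
          then show thesis using that[of y] xI by blast
        qed
        have "sin y = sin x \<and> cos y = cos x" using y(1) by (simp add: complex_eq_iff)
        then obtain n :: int where n: "y = x + 2 * pi * n" using sin_cos_eq_iff[of y x] by auto
        have "\<bar>y - x\<bar> < 2 * pi" using y(2) xI by auto
        then have "2 * pi * \<bar>real_of_int n\<bar> < 2 * pi * 1" using n by (simp add: abs_mult)
        then have "\<bar>real_of_int n\<bar> < 1" using mult_less_cancel_left_pos[of "2 * pi"] pi_gt_zero by force
        then have "n = 0" by linarith
        then show False using n y(3) by simp
      qed
    next
      assume "x \<notin> {a<..<b} \<inter> {0<..<2 * pi}"
      moreover have "x = 0 \<Longrightarrow> cis x = 1" "x = 2 * pi \<Longrightarrow> cis x = 1" by (auto simp: complex_eq_iff)
      ultimately show "cis x \<in> K" using x unfolding K_def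
        by (cases "x = 0 \<or> x = 2 * pi") auto
    qed
    \<comment> \<open>Continuous functions on the circle increasing to the indicator of the arc outside K.\<close>
    define u where "u n z = min 1 (real n * infdist z K)" for n z
    have u: "continuous_on UNIV (u n)" for n
      unfolding u_def by (intro continuous_intros)
    have lim: "(\<lambda>n. integral {0..2 * pi} (\<lambda>x. f x * u n (cis x))) \<longlonglongrightarrow>
        integral {0..2 * pi} (\<lambda>x. f x * indicator ({a<..<b} \<inter> {0<..<2 * pi}) x)"
    proof (rule dominated_convergence(2)[where h = "\<lambda>_. B"])
      show "(\<lambda>x. f x * u n (cis x)) integrable_on {0..2 * pi}" for n
        by (rule int, rule cont_cis[OF u])
      show "norm (f x * u n (cis x)) \<le> B" for n x
      proof -
        have "\<bar>f x\<bar> * \<bar>u n (cis x)\<bar> \<le> B * 1"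
          using bd[of x] infdist_nonneg[of "cis x" K] B by (intro mult_mono) (auto simp: u_def)
        then show ?thesis by (simp add: abs_mult)
      qed
      fix x assume x: "x \<in> {0..2 * pi}"
      have "(\<lambda>n. u n (cis x)) \<longlonglongrightarrow> indicator ({a<..<b} \<inter> {0<..<2 * pi}) x"
      proof (cases "cis x \<in> K")
        case True
        then show ?thesis using inK[OF x] by (simp add: u_def)
      next
        case False
        then have pos: "infdist (cis x) K > 0"
          using K by (simp add: infdist_pos_not_in_closed)
        obtain N where N: "1 < real N * infdist (cis x) K" using reals_Archimedean3[OF pos] by blast
        have "eventually (\<lambda>n. u n (cis x) = 1) sequentially"
          using eventually_ge_at_top[of N]
        proof eventually_elim
          case (elim n)
          then have "real N * infdist (cis x) K \<le> real n * infdist (cis x) K"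
            using pos by (intro mult_right_mono) auto
          then show ?case using N by (simp add: u_def)
        qed
        then show ?thesis using inK[OF x] False by (simp add: tendsto_eventually)
      qed
      then show "(\<lambda>n. f x * u n (cis x)) \<longlonglongrightarrow> f x * indicator ({a<..<b} \<inter> {0<..<2 * pi}) x"
        by (intro tendsto_mult tendsto_const)
    qed auto
    then show ?thesis unfolding cont0[OF u] by (simp add: LIMSEQ_const_iff)
  qed
  have "AE x in lborel. (if x \<in> {0..2 * pi} then f x else 0) = 0"
  proof (rule AE_zero_of_interval_integrals)
    show "\<bar>if x \<in> {0..2 * pi} then f x else 0\<bar> \<le> B" for x using bd[of x] B by auto
    fix a b :: real
    have "integral {a..b} (\<lambda>x. if x \<in> {0..2 * pi} then f x else 0) =
        integral UNIV (\<lambda>x. if x \<in> {a..b} then if x \<in> {0..2 * pi} then f x else 0 else 0)"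
      by (rule integral_restrict_UNIV[symmetric])
    also have "\<dots> = integral UNIV (\<lambda>x. if x \<in> {0..2 * pi} then f x * indicator ({a<..<b} \<inter> {0<..<2 * pi}) x else 0)"
      by (rule integral_spike[of "{a, b, 0, 2 * pi}"]) (auto simp: indicator_def)
    also have "\<dots> = 0" using ivl by (simp only: integral_restrict_UNIV)
    finally show "integral {a..b} (\<lambda>x. if x \<in> {0..2 * pi} then f x else 0) = 0" .
  qed measurable
  then show ?thesis by eventually_elim (auto split: if_splits)
qed

text \<open>The du Bois-Reymond lemma on the circle. Every trigonometric polynomial is a constant
  plus the derivative of another one, so \<open>f\<close> minus its mean is orthogonal to all of
  them.\<close>

lemma AE_const_of_weak_derivative_zero:
  fixes f :: "real \<Rightarrow> real"
  assumes meas [measurable]: "f \<in> borel_measurable borel" and bd: "\<And>x. \<bar>f x\<bar> \<le> B"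
    and weak: "\<And>p. trig_poly p \<Longrightarrow> integral {0..2 * pi} (\<lambda>x. f x * deriv p x) = 0"
  shows "\<exists>c. AE x in lborel. x \<in> {0..2 * pi} \<longrightarrow> f x = c"
proof -
  define c where "c = integral {0..2 * pi} f / (2 * pi)"
  have "AE x in lborel. x \<in> {0..2 * pi} \<longrightarrow> f x - c = 0"
  proof (rule AE_zero_of_orthogonal_trig_poly)
    show "\<bar>f x - c\<bar> \<le> B + \<bar>c\<bar>" for x using bd[of x] by linarith
    fix p assume p: "trig_poly p"
    then obtain q d where q: "trig_poly q" "\<And>x. (q has_real_derivative p x - d) (at x)"
      using trig_poly_has_antiderivative by blast
    have dq: "deriv q x = p x - d" for x using q(2) by (rule DERIV_imp_deriv)
    have "((\<lambda>x. p x - d) has_integral q (2 * pi) - q 0) {0..2 * pi}"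
      using q(2) by (intro fundamental_theorem_of_calculus)
        (auto intro: has_field_derivative_at_within simp flip: has_real_derivative_iff_has_vector_derivative)
    then have ip: "((\<lambda>x. p x - d) has_integral 0) {0..2 * pi}"
      using trig_poly_periodic[OF q(1), of 0] by simp
    have "trig_poly (\<lambda>x. p x + - d)" by (intro trig_poly.add p trig_poly_const)
    then have cont: "continuous_on S (\<lambda>x. p x - d)" for S
      using continuous_on_trig_poly by fastforce
    then have [measurable]: "(\<lambda>x. p x - d) \<in> borel_measurable borel"
      by (rule borel_measurable_continuous_onI)
    have "compact ((\<lambda>x. p x - d) ` {0..2 * pi})" by (intro compact_continuous_image cont compact_Icc)
    then obtain W where W: "\<And>x. x \<in> {0..2 * pi} \<Longrightarrow> \<bar>p x - d\<bar> \<le> W"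
      by (metis (no_types, lifting) compact_imp_bounded bounded_real imageI)
    have "(\<lambda>x. f x * (p x - d)) integrable_on {0..2 * pi}"
    proof (rule integrable_on_bounded_borel)
      show "\<bar>f x * (p x - d)\<bar> \<le> B * W" if "x \<in> {0..2 * pi}" for x
        using bd[of x] W[OF that] by (simp add: abs_mult mult_mono')
    qed measurable
    then have i1: "((\<lambda>x. f x * (p x - d)) has_integral 0) {0..2 * pi}"
      using weak[OF q(1)] by (simp add: has_integral_iff dq)
    have i2: "(f has_integral 2 * pi * c) {0..2 * pi}"
      using integrable_on_bounded_borel[OF meas bd] by (simp add: has_integral_iff c_def)
    have i3: "((\<lambda>x. c) has_integral 2 * pi * c) {0..2 * pi}"
      using has_integral_const_real[of c 0 "2 * pi"] by simp
    \<comment> \<open>The integrand equals \<open>(f x - c) * p x\<close>. Its three terms integrate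
      to zero by the weak hypothesis for \<open>q\<close>, by the choice of \<open>c\<close> as the
      mean of \<open>f\<close>, and by the periodicity of \<open>q\<close>.\<close>
    have "((\<lambda>x. f x * (p x - d) + d * (f x - c) - c * (p x - d)) has_integral
        0 + d * (2 * pi * c - 2 * pi * c) - c * 0) {0..2 * pi}"
      by (intro has_integral_add has_integral_diff has_integral_mult_right i1 i2 i3 ip)
    moreover have "(\<lambda>x. f x * (p x - d) + d * (f x - c) - c * (p x - d)) = (\<lambda>x. (f x - c) * p x)"
      by (auto simp: algebra_simps)
    ultimately show "integral {0..2 * pi} (\<lambda>x. (f x - c) * p x) = 0" by (simp add: integral_unique)
  qed measurable
  then show ?thesis by auto
qed

section \<open>The first integral of the steady equation\<close>

lemma periodic_int_multiple:
  fixes f :: "real \<Rightarrow> 'a"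
  assumes "\<And>x. f (x + p) = f x"
  shows "f (x + of_int k * p) = f x"
proof -
  have nat: "f (x + of_nat n * p) = f x" for x n
  proof (induction n)
    case (Suc n)
    have "x + of_nat (Suc n) * p = (x + of_nat n * p) + p" by (simp add: algebra_simps)
    then show ?case using Suc assms by metis
  qed simp
  show ?thesis
  proof (cases "k \<ge> 0")
    case True
    then show ?thesis using nat[of x "nat k"] by simp
  next
    case False
    then show ?thesis using nat[of "x + of_int k * p" "nat (- k)"] by simp
  qed
qed

lemma ex_int_translate_into_period:
  fixes x p :: real
  assumes "p > 0"
  obtains k :: int where "x + of_int k * p \<in> {0..<p}"
proof
  have "x + of_int (- \<lfloor>x / p\<rfloor>) * p = p * frac (x / p)"
    using assms by (simp add: frac_def right_diff_distrib mult.commute)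
  moreover have "p * frac (x / p) < p * 1"
    using assms by (intro mult_strict_left_mono frac_lt_1)
  ultimately show "x + of_int (- \<lfloor>x / p\<rfloor>) * p \<in> {0..<p}" using assms by simp
qed

lemma periodic_continuous_bounded:
  fixes f :: "real \<Rightarrow> real"
  assumes p: "p > 0" and per: "\<And>x. f (x + p) = f x" and cont: "continuous_on UNIV f"
  obtains B where "\<And>x. \<bar>f x\<bar> \<le> B"
proof -
  have "compact (f ` {0..p})"
    by (intro compact_continuous_image continuous_on_subset[OF cont]) auto
  then obtain B where B: "\<And>x. x \<in> {0..p} \<Longrightarrow> \<bar>f x\<bar> \<le> B"
    by (metis compact_imp_bounded bounded_real imageI)
  show thesis
  proof (rule that)
    fix x
    obtain k :: int where "x + of_int k * p \<in> {0..<p}"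
      using ex_int_translate_into_period[OF p] .
    then have "\<bar>f (x + of_int k * p)\<bar> \<le> B" by (intro B) simp
    then show "\<bar>f x\<bar> \<le> B" by (simp only: periodic_int_multiple[of f p, OF per])
  qed
qed

text \<open>\<open>G_eq\<close> is the integrated form of 4 G + G'' = g, suited to a second
  derivative that is only a bounded density. \<open>steady\<close> is the distributional equation (G
  g)' - G' g = 0 tested on the circle, with the overall sign reversed.\<close>

locale steady_solution =
  fixes m :: nat and g G :: "real \<Rightarrow> real"
  assumes m: "m \<ge> 4"
    and g_meas: "g \<in> borel_measurable lborel"
    and g_bdd: "bounded (range g)"
    and g_sym: "\<forall>x. g (x + 2 * pi / real m) = g x"
    and G_sym: "\<forall>x. G (x + 2 * pi / real m) = G x"
    and G_diff: "\<forall>x. G differentiable (at x)"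
    and G_eq: "\<forall>a b. a \<le> b \<longrightarrow>
                 deriv G b - deriv G a = integral {a..b} (\<lambda>x. g x - 4 * G x)"
    and steady: "\<forall>\<phi>. smooth_periodic \<phi> \<longrightarrow>
                 integral {0..2 * pi} (\<lambda>x. G x * g x * deriv \<phi> x + deriv G x * g x * \<phi> x) = 0"
begin

abbreviation H :: "real \<Rightarrow> real" where "H \<equiv> deriv G"

definition Q :: "real \<Rightarrow> real" where "Q x = (H x)\<^sup>2 + 4 * (G x)\<^sup>2"

section \<open>Regularity, periodicity and bounds for \<open>G\<close>, \<open>H\<close> and
  \<open>Q\<close>\<close>

lemma g_borel [measurable]: "g \<in> borel_measurable borel"
  using g_meas by simp

lemma has_derivative_G: "(G has_real_derivative H x) (at x)"
  using G_diff by (simp add: DERIV_deriv_iff_real_differentiable)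

lemma continuous_G: "continuous_on S G"
  using has_derivative_G by (meson DERIV_isCont continuous_at_imp_continuous_on)

lemma G_borel [measurable]: "G \<in> borel_measurable borel"
  by (rule borel_measurable_continuous_onI[OF continuous_G])

lemma H_sym: "H (x + 2 * pi / real m) = H x"
proof (rule DERIV_imp_deriv)
  have "((\<lambda>x. G (x + 2 * pi / real m)) has_real_derivative H x) (at x)"
    using has_derivative_G[of x] G_sym by simp
  then show "(G has_real_derivative H x) (at (x + 2 * pi / real m))"
    by (simp only: DERIV_shift)
qed

lemma period_multiple: "x + of_int k * (2 * pi) = x + of_int (k * int m) * (2 * pi / real m)"
  using m by simp

lemma g_periodic: "g (x + of_int k * (2 * pi)) = g x"
  and G_periodic: "G (x + of_int k * (2 * pi)) = G x"
  and H_periodic: "H (x + of_int k * (2 * pi)) = H x"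
  unfolding period_multiple by (rule periodic_int_multiple; use g_sym G_sym H_sym in simp)+

lemma Q_periodic: "Q (x + of_int k * (2 * pi)) = Q x"
  by (simp only: Q_def G_periodic H_periodic)

lemma g_bound: obtains B where "\<And>x. \<bar>g x\<bar> \<le> B"
  using g_bdd by (auto simp: bounded_real)

lemma G_bound: obtains B where "\<And>x. \<bar>G x\<bar> \<le> B"
  using periodic_continuous_bounded[of "2 * pi" G] G_periodic[of _ 1] continuous_G by auto

lemma source_bound: obtains B where "\<And>x. \<bar>g x - 4 * G x\<bar> \<le> B"
proof -
  obtain B C where B: "\<And>x. \<bar>g x\<bar> \<le> B" and C: "\<And>x. \<bar>G x\<bar> \<le> C"
    using g_bound G_bound by metis
  have "\<bar>g x - 4 * G x\<bar> \<le> B + 4 * C" for x using B[of x] C[of x] by linarith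
  then show thesis using that by blast
qed

text \<open>\<open>G_eq\<close> fixes only the value of \<open>integral\<close>, which is 0 by
  default for a non-integrable function; the boundedness and measurability of the source supply
  integrability.\<close>

lemma H_has_integral:
  assumes "a \<le> b"
  shows "((\<lambda>x. g x - 4 * G x) has_integral H b - H a) {a..b}"
proof -
  obtain B where "\<And>x. \<bar>g x - 4 * G x\<bar> \<le> B" using source_bound by blast
  then have "(\<lambda>x. g x - 4 * G x) integrable_on {a..b}"
    by (intro integrable_on_bounded_borel) auto
  then show ?thesis using G_eq assms by (simp add: has_integral_iff)
qed

lemma continuous_H: "continuous_on S H"
proof -
  obtain B where B: "\<And>x. \<bar>g x - 4 * G x\<bar> \<le> B" using source_bound by blast
  have B0: "B \<ge> 0" using B[of 0] by linarith
  have le: "\<bar>H y - H x\<bar> \<le> B * (y - x)" if "x \<le> y" for x y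
    using has_integral_bound_real[OF B0 finite.emptyI H_has_integral[OF that]] B that by auto
  have "B-lipschitz_on UNIV H"
  proof (rule lipschitz_onI)
    show "dist (H x) (H y) \<le> B * dist x y" for x y
      using le[of x y] le[of y x] by (cases "x \<le> y") (auto simp: dist_real_def abs_minus_commute)
  qed (rule B0)
  then have "continuous_on UNIV H" by (rule lipschitz_on_continuous_on)
  then show ?thesis using continuous_on_subset by blast
qed

lemma H_borel [measurable]: "H \<in> borel_measurable borel"
  by (rule borel_measurable_continuous_onI[OF continuous_H])

lemma H_bound: obtains B where "\<And>x. \<bar>H x\<bar> \<le> B"
  using periodic_continuous_bounded[of "2 * pi" H] H_periodic[of _ 1] continuous_H by auto

lemma continuous_Q: "continuous_on S Q"
  unfolding Q_def by (intro continuous_intros continuous_G continuous_H)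

lemma Q_borel [measurable]: "Q \<in> borel_measurable borel"
  by (rule borel_measurable_continuous_onI[OF continuous_Q])

lemma Q_bound: obtains B where "\<And>x. \<bar>Q x\<bar> \<le> B"
  using periodic_continuous_bounded[of "2 * pi" Q] Q_periodic[of _ 1] continuous_Q by auto

text \<open>\<open>H\<close> is only Lipschitz here, so its square goes through
  \<open>product_rule_integral\<close>, while the square of \<open>G\<close> is classically
  differentiable. The contributions \<open>- 8 * G * H\<close> and \<open>8 * G * H\<close>
  cancel.\<close>

lemma Q_has_integral:
  assumes "a \<le> b"
  shows "((\<lambda>x. 2 * H x * g x) has_integral Q b - Q a) {a..b}"
proof -
  obtain B C where B: "\<And>x. \<bar>g x - 4 * G x\<bar> \<le> B" and C: "\<And>x. \<bar>H x\<bar> \<le> C"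
    using source_bound H_bound by metis
  have i: "(\<lambda>t. (g t - 4 * G t) * H t + H t * (g t - 4 * G t)) integrable_on {x..y}" for x y
  proof (rule integrable_on_bounded_borel)
    fix t
    have "\<bar>(g t - 4 * G t) * H t\<bar> \<le> B * C" using B[of t] C[of t] by (simp add: abs_mult mult_mono')
    then show "\<bar>(g t - 4 * G t) * H t + H t * (g t - 4 * G t)\<bar> \<le> 2 * (B * C)"
      by (simp add: mult.commute)
  qed measurable
  have 1: "((\<lambda>t. (g t - 4 * G t) * H t + H t * (g t - 4 * G t)) has_integral (H b * H b - H a * H a)) {a..b}"
    by (rule product_rule_integral[OF H_has_integral H_has_integral B B i assms])
  have 2: "((\<lambda>t. 8 * G t * H t) has_integral (4 * (G b)\<^sup>2 - 4 * (G a)\<^sup>2)) {a..b}"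
  proof (rule fundamental_theorem_of_calculus[OF assms])
    fix x
    have "((\<lambda>x. 4 * (G x)\<^sup>2) has_real_derivative 8 * G x * H x) (at x)"
      by (auto intro!: derivative_eq_intros has_derivative_G)
    then show "((\<lambda>x. 4 * (G x)\<^sup>2) has_vector_derivative 8 * G x * H x) (at x within {a..b})"
      by (simp add: has_field_derivative_at_within flip: has_real_derivative_iff_has_vector_derivative)
  qed
  from has_integral_add[OF 1 2] show ?thesis
    by (simp add: Q_def power2_eq_square algebra_simps)
qed

text \<open>Integrating the derivative of \<open>Q * p\<close> over a period gives zero; subtracting
  this from twice the steady equation tested with \<open>p\<close> removes the terms containing
  \<open>H * g * p\<close>.\<close>

lemma weak_first_integral:
  assumes p: "trig_poly p"
  shows "integral {0..2 * pi} (\<lambda>x. (2 * G x * g x - Q x) * deriv p x) = 0"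
proof -
  obtain q where q: "trig_poly q" "\<And>x. (p has_real_derivative q x) (at x)"
    using trig_poly_has_derivative[OF p] by blast
  have dp: "deriv p = q" using q(2) by (auto intro: DERIV_imp_deriv)
  have bp: "\<exists>B. \<forall>x. \<bar>r x\<bar> \<le> B" if "trig_poly r" for r
    using periodic_continuous_bounded[of "2 * pi" r] trig_poly_periodic[OF that] continuous_on_trig_poly[OF that]
    by (metis mult_pos_pos pi_gt_zero zero_less_numeral)
  obtain Bp Bq where Bp: "\<And>x. \<bar>p x\<bar> \<le> Bp" and Bq: "\<And>x. \<bar>q x\<bar> \<le> Bq" using bp p q(1) by metis
  obtain Bg BG BH BQ where Bg: "\<And>x. \<bar>g x\<bar> \<le> Bg" and BG: "\<And>x. \<bar>G x\<bar> \<le> BG"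
    and BH: "\<And>x. \<bar>H x\<bar> \<le> BH" and BQ: "\<And>x. \<bar>Q x\<bar> \<le> BQ"
    using g_bound G_bound H_bound Q_bound by metis
  have [measurable]: "p \<in> borel_measurable borel" "q \<in> borel_measurable borel"
    using continuous_on_trig_poly p q(1) by (auto intro: borel_measurable_continuous_onI)
  have prod: "\<bar>u * v\<bar> \<le> b * c" if "\<bar>u\<bar> \<le> b" "\<bar>v\<bar> \<le> c" for u v b c :: real
    using that by (simp add: abs_mult mult_mono')
  have Hg: "\<bar>2 * H x * g x\<bar> \<le> 2 * BH * Bg" for x
    using Bg BH by (intro prod) (auto simp: abs_mult)
  have Gg: "\<bar>2 * G x * g x\<bar> \<le> 2 * BG * Bg" for x
    using Bg BG by (intro prod) (auto simp: abs_mult)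
  have "((\<lambda>t. 2 * H t * g t * p t + Q t * q t) has_integral Q (2 * pi) * p (2 * pi) - Q 0 * p 0) {0..2 * pi}"
  proof (rule product_rule_integral)
    show "((\<lambda>t. 2 * H t * g t) has_integral Q y - Q x) {x..y}" if "x \<le> y" for x y
      by (rule Q_has_integral[OF that])
    show "(q has_integral p y - p x) {x..y}" if "x \<le> y" for x y
      using q(2) by (intro fundamental_theorem_of_calculus that)
        (simp add: has_field_derivative_at_within flip: has_real_derivative_iff_has_vector_derivative)
    show "\<bar>2 * H x * g x\<bar> \<le> max (2 * BH * Bg) Bq" for x using Hg[of x] by linarith
    show "\<bar>q x\<bar> \<le> max (2 * BH * Bg) Bq" for x using Bq[of x] by linarith
    show "(\<lambda>t. 2 * H t * g t * p t + Q t * q t) integrable_on {x..y}" for x y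
    proof (rule integrable_on_bounded_borel)
      show "\<bar>2 * H t * g t * p t + Q t * q t\<bar> \<le> 2 * BH * Bg * Bp + BQ * Bq" for t
        using prod[OF Hg Bp, of t t] prod[OF BQ Bq, of t t] by linarith
    qed measurable
  qed simp
  then have 1: "((\<lambda>t. 2 * H t * g t * p t + Q t * q t) has_integral 0) {0..2 * pi}"
    using trig_poly_periodic[OF p, of 0] Q_periodic[of 0 1] by simp
  have "(\<lambda>x. G x * g x * deriv p x + H x * g x * p x) integrable_on {0..2 * pi}"
  proof (rule integrable_on_bounded_borel)
    show "\<bar>G t * g t * deriv p t + H t * g t * p t\<bar> \<le> (BG * Bg) * Bq + (BH * Bg) * Bp" for t
      using prod[OF prod[OF BG Bg] Bq, of t t t] prod[OF prod[OF BH Bg] Bp, of t t t] 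
      unfolding dp by linarith
  qed (unfold dp, measurable)
  then have "((\<lambda>x. G x * g x * deriv p x + H x * g x * p x) has_integral 0) {0..2 * pi}"
    using steady smooth_periodic_trig_poly[OF p] by (simp add: has_integral_iff)
  from has_integral_diff[OF has_integral_mult_right[OF this, of 2] 1]
  have "((\<lambda>x. (2 * G x * g x - Q x) * deriv p x) has_integral 0) {0..2 * pi}"
    by (simp add: dp algebra_simps)
  then show ?thesis by (rule integral_unique)
qed

lemma first_integral: "\<exists>E. AE x in lborel. 2 * G x * g x = Q x - E"
proof -
  define f where "f x = 2 * G x * g x - Q x" for x
  have [measurable]: "f \<in> borel_measurable borel" unfolding f_def by measurable
  obtain Bg BG BQ where Bg: "\<And>x. \<bar>g x\<bar> \<le> Bg" and BG: "\<And>x. \<bar>G x\<bar> \<le> BG" and BQ: "\<And>x. \<bar>Q x\<bar> \<le> BQ"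
    using g_bound G_bound Q_bound by metis
  have bd: "\<bar>f x\<bar> \<le> 2 * (BG * Bg) + BQ" for x
  proof -
    have "\<bar>G x * g x\<bar> \<le> BG * Bg" using Bg[of x] BG[of x] by (simp add: abs_mult mult_mono')
    then show ?thesis using BQ[of x] unfolding f_def by linarith
  qed
  have "\<exists>c. AE x in lborel. x \<in> {0..2 * pi} \<longrightarrow> f x = c"
    by (rule AE_const_of_weak_derivative_zero[OF _ bd]) (simp_all only: f_def weak_first_integral, measurable)
  then obtain c where c: "AE x in lborel. x \<in> {0..2 * pi} \<longrightarrow> f x = c" by blast
  have per: "f (of_int k * (2 * pi) + x) = f x" for k x
    using G_periodic[of x k] g_periodic[of x k] Q_periodic[of x k] by (simp add: f_def add.commute)
  \<comment> \<open>Countably many translates of one null set are still null, so the identity on one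
    period spreads to the whole line.\<close>
  have "AE x in lborel. \<forall>k::int. of_int k * (2 * pi) + x \<in> {0..2 * pi} \<longrightarrow> f (of_int k * (2 * pi) + x) = c"
    unfolding AE_all_countable
  proof
    fix k :: int
    show "AE x in lborel. of_int k * (2 * pi) + x \<in> {0..2 * pi} \<longrightarrow> f (of_int k * (2 * pi) + x) = c"
      by (rule AE_lborel_shift[OF _ c]) measurable
  qed
  then have "AE x in lborel. f x = c"
  proof eventually_elim
    case (elim x)
    obtain k :: int where "x + of_int k * (2 * pi) \<in> {0..<2 * pi}"
      using ex_int_translate_into_period[of "2 * pi" x] by auto
    then show ?case using elim[rule_format, of k] per[of k x] by (simp add: add.commute)
  qed
  then have "AE x in lborel. 2 * G x * g x = Q x - (- c)"
    by eventually_elim (simp add: f_def)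
  then show ?thesis by blast
qed

end

section \<open>Nodal intervals and jumps\<close>

lemma nonpos_derivative_at_right_end:
  fixes f :: "real \<Rightarrow> real"
  assumes "(f has_real_derivative d) (at b)" "a < b" "\<And>x. x \<in> {a<..<b} \<Longrightarrow> f b \<le> f x"
  shows "d \<le> 0"
proof (rule ccontr)
  assume "\<not> d \<le> 0"
  then obtain e where e: "e > 0" "\<And>h. 0 < h \<Longrightarrow> h < e \<Longrightarrow> f (b - h) < f b"
    using DERIV_pos_inc_left[OF assms(1)] by auto
  define h where "h = min (e / 2) ((b - a) / 2)"
  have "0 < h" "h < e" "b - h \<in> {a<..<b}" using e(1) assms(2) by (auto simp: h_def min_def field_simps)
  then show False using e(2) assms(3) by fastforce
qed

lemma nonneg_derivative_at_left_end:
  fixes f :: "real \<Rightarrow> real"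
  assumes "(f has_real_derivative d) (at a)" "a < b" "\<And>x. x \<in> {a<..<b} \<Longrightarrow> f a \<le> f x"
  shows "d \<ge> 0"
proof (rule ccontr)
  assume "\<not> d \<ge> 0"
  then obtain e where e: "e > 0" "\<And>h. 0 < h \<Longrightarrow> h < e \<Longrightarrow> f (a + h) < f a"
    using DERIV_neg_dec_right[OF assms(1)] by auto
  define h where "h = min (e / 2) ((b - a) / 2)"
  have "0 < h" "h < e" "a + h \<in> {a<..<b}" using e(1) assms(2) by (auto simp: h_def min_def field_simps)
  then show False using e(2) assms(3) by fastforce
qed

text \<open>Green's identity with \<open>sin (2 * (x - a))\<close> yields
  \<open>c * (1 - cos (2 * (b - a))) = 2 * (v b * sin (2 * (b - a)))\<close>. For
  \<open>0 < b - a \<le> pi / 2\<close> the cosine factor is positive and the sine nonnegative, so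
  \<open>c\<close> inherits its sign from the end slope \<open>v b\<close>.\<close>

lemma forced_oscillator_sign:
  fixes u v :: "real \<Rightarrow> real"
  assumes ab: "a < b" "b - a \<le> pi / 2"
    and cont: "continuous_on {a..b} u" "continuous_on {a..b} v"
    and du: "\<And>x. x \<in> {a<..<b} \<Longrightarrow> (u has_real_derivative v x) (at x)"
    and dv: "\<And>x. x \<in> {a<..<b} \<Longrightarrow> (v has_real_derivative c - 4 * u x) (at x)"
    and bc: "u a = 0" "u b = 0"
  shows "v b \<le> 0 \<Longrightarrow> c \<le> 0" "v b \<ge> 0 \<Longrightarrow> c \<ge> 0"
proof -
  \<comment> \<open>The first two terms form the Wronskian of \<open>u\<close> with
    \<open>sin (2 * (x - a))\<close>, whose derivative is \<open>c * sin (2 * (x - a))\<close>; the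
    last term cancels it, so \<open>W\<close> is conserved.\<close>
  define W where "W x = v x * sin (2 * (x - a)) - 2 * u x * cos (2 * (x - a)) + c / 2 * cos (2 * (x - a))" for x
  have "W b = W a"
  proof (rule DERIV_isconst_end[OF ab(1)])
    show "continuous_on {a..b} W" unfolding W_def by (intro continuous_intros cont)
    show "(W has_real_derivative 0) (at x)" if "a < x" "x < b" for x
      unfolding W_def using that
      by (auto intro!: derivative_eq_intros du dv simp: algebra_simps)
  qed
  then have eq: "c * (1 - cos (2 * (b - a))) = 2 * (v b * sin (2 * (b - a)))"
    by (simp add: W_def bc field_simps)
  have "cos (2 * (b - a)) < cos 0"
    using ab pi_gt_zero by (intro cos_monotone_0_pi) auto
  then have pos: "1 - cos (2 * (b - a)) > 0" by simp
  have "sin (2 * (b - a)) \<ge> 0" using ab by (intro sin_ge_zero) auto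
  then have "v b \<le> 0 \<Longrightarrow> c * (1 - cos (2 * (b - a))) \<le> 0" "v b \<ge> 0 \<Longrightarrow> c * (1 - cos (2 * (b - a))) \<ge> 0"
    unfolding eq by (auto simp: mult_nonpos_nonneg)
  then show "v b \<le> 0 \<Longrightarrow> c \<le> 0" "v b \<ge> 0 \<Longrightarrow> c \<ge> 0"
    using pos by (auto simp: mult_le_0_iff zero_le_mult_iff)
qed

locale steady_energy = steady_solution +
  fixes E :: real
  assumes energy: "AE x in lborel. 2 * G x * g x = Q x - E"
begin

text \<open>The energy identity holds only almost everywhere and cannot be evaluated at
  \<open>x\<close>. It does give \<open>\<bar>Q - E\<bar> \<le> 2 * B * \<bar>G\<bar>\<close> almost
  everywhere, and both sides are continuous.\<close>

lemma Q_at_zero: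
  assumes "G x = 0"
  shows "Q x = E"
proof -
  obtain B where B: "\<And>x. \<bar>g x\<bar> \<le> B" using g_bound by blast
  have "\<bar>Q x - E\<bar> \<le> 2 * B * \<bar>G x\<bar>"
  proof (rule continuous_le_of_AE_le[where u = "\<lambda>x. \<bar>Q x - E\<bar>" and v = "\<lambda>x. 2 * B * \<bar>G x\<bar>"])
    show "continuous_on UNIV (\<lambda>x. \<bar>Q x - E\<bar>)" "continuous_on UNIV (\<lambda>x. 2 * B * \<bar>G x\<bar>)"
      by (intro continuous_intros continuous_Q continuous_G)+
    show "AE x in lborel. \<bar>Q x - E\<bar> \<le> 2 * B * \<bar>G x\<bar>"
      using energy
    proof eventually_elim
      case (elim x)
      have "\<bar>Q x - E\<bar> = 2 * \<bar>G x\<bar> * \<bar>g x\<bar>" by (simp add: abs_mult flip: elim)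
      also have "\<dots> \<le> 2 * \<bar>G x\<bar> * B" by (rule mult_left_mono[OF B]) simp
      finally show ?case by (simp only: mult_ac)
    qed
  qed
  then show ?thesis using assms by simp
qed

text \<open>A bootstrap: off the zeros of \<open>G\<close>, the quotient \<open>\<gamma>\<close> is
  a continuous representative of \<open>g\<close>, so \<open>H\<close> is classically differentiable
  there. Then \<open>Q\<close> has derivative \<open>2 * H * \<gamma>\<close>, and the quotient rule
  makes the derivative of \<open>\<gamma>\<close> vanish.\<close>

lemma const_on_nonzero:
  assumes S: "open S" "connected S" and nz: "\<And>x. x \<in> S \<Longrightarrow> G x \<noteq> 0"
  obtains c where "\<And>x. x \<in> S \<Longrightarrow> Q x - E = 2 * c * G x"
    "AE x in lborel. x \<in> S \<longrightarrow> g x = c"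
    "\<And>x. x \<in> S \<Longrightarrow> (H has_real_derivative c - 4 * G x) (at x)"
proof -
  define \<gamma> where "\<gamma> x = (Q x - E) / (2 * G x)" for x
  have ae: "AE x in lborel. x \<in> S \<longrightarrow> g x = \<gamma> x"
    using energy
  proof eventually_elim
    case (elim x)
    show ?case
    proof
      assume "x \<in> S"
      then show "g x = \<gamma> x" using nz[of x] by (simp add: \<gamma>_def flip: elim)
    qed
  qed
  have dH: "(H has_real_derivative \<gamma> x - 4 * G x) (at x)" if x: "x \<in> S" for x
  proof -
    obtain e where e: "e > 0" "cball x e \<subseteq> S" using S(1) x by (meson open_contains_cball)
    define a b where "a = x - e" and "b = x + e"
    have ab: "a < x" "x < b" "{a..b} \<subseteq> S" using e by (auto simp: a_def b_def cball_eq_atLeastAtMost)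
    have "continuous_on {a..b} (\<lambda>t. \<gamma> t - 4 * G t)"
      unfolding \<gamma>_def using ab(3) nz by (intro continuous_intros continuous_Q continuous_G) auto
    then have "((\<lambda>y. integral {a..y} (\<lambda>t. \<gamma> t - 4 * G t)) has_real_derivative \<gamma> x - 4 * G x) (at x within {a..b})"
      by (rule integral_has_real_derivative) (use ab in auto)
    then have d: "((\<lambda>y. H a + integral {a..y} (\<lambda>t. \<gamma> t - 4 * G t)) has_real_derivative \<gamma> x - 4 * G x) (at x within {a..b})"
      by (auto intro!: derivative_eq_intros)
    have eq: "H y = H a + integral {a..y} (\<lambda>t. \<gamma> t - 4 * G t)" if "y \<in> {a..b}" for y
    proof -
      have "AE t in lborel. t \<in> {a..y} \<longrightarrow> g t - 4 * G t = \<gamma> t - 4 * G t"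
        using ae
      proof eventually_elim
        case (elim t)
        have "t \<in> {a..y} \<Longrightarrow> t \<in> S" using ab(3) that by auto
        then show ?case using elim by simp
      qed
      then have "((\<lambda>t. \<gamma> t - 4 * G t) has_integral H y - H a) {a..y}"
        using H_has_integral[of a y] that has_integral_AE[of "{a..y}" "\<lambda>t. g t - 4 * G t" "\<lambda>t. \<gamma> t - 4 * G t"]
        by simp
      then show ?thesis by (simp add: integral_unique)
    qed
    have "(H has_real_derivative \<gamma> x - 4 * G x) (at x within {a..b})"
      using has_field_derivative_transform_within[OF d zero_less_one _ eq[symmetric]] ab by simp
    then show ?thesis using ab at_within_Icc_at[of a x b] by simp
  qed
  have "(\<gamma> has_real_derivative 0) (at x)" if x: "x \<in> S" for x
  proof -
    have "(Q has_real_derivative 2 * H x * \<gamma> x) (at x)"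
      unfolding Q_def by (auto intro!: derivative_eq_intros dH[OF x] has_derivative_G simp: algebra_simps)
    then have d: "((\<lambda>x. (Q x - E) / (2 * G x)) has_real_derivative
        ((2 * H x * \<gamma> x - 0) * (2 * G x) - (Q x - E) * (2 * H x)) / ((2 * G x) * (2 * G x))) (at x)"
      using nz[OF x] by (intro DERIV_divide DERIV_diff DERIV_cmult has_derivative_G DERIV_const) auto
    have eq: "Q x - E = 2 * G x * \<gamma> x" using nz[OF x] by (simp add: \<gamma>_def)
    have "(2 * H x * \<gamma> x - 0) * (2 * G x) - (Q x - E) * (2 * H x) = 0" unfolding eq by simp
    then show ?thesis using d unfolding \<gamma>_def[abs_def] by simp
  qed
  then have "\<gamma> constant_on S" by (rule has_field_derivative_0_imp_constant_on[OF _ S(2,1)])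
  then obtain c where c: "\<And>x. x \<in> S \<Longrightarrow> \<gamma> x = c" by (auto simp: constant_on_def)
  show thesis
  proof (rule that)
    show "Q x - E = 2 * c * G x" if "x \<in> S" for x
      using c[OF that] nz[OF that] by (simp add: \<gamma>_def field_simps)
    show "AE x in lborel. x \<in> S \<longrightarrow> g x = c" using ae by eventually_elim (use c in auto)
    show "(H has_real_derivative c - 4 * G x) (at x)" if "x \<in> S" for x
      using dH[OF that] c[OF that] by simp
  qed
qed

text \<open>The ends are the last zero before \<open>x\<close> and the first one after it. The left
  end shifted by \<open>2 * pi / m\<close> is again a zero and must lie beyond \<open>x\<close>,
  which bounds the length; \<open>m \<ge> 4\<close> enters here.\<close>

lemma nodal_interval:
  assumes z: "G z = 0" and x: "G x \<noteq> 0"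
  obtains a b where "a < x" "x < b" "b - a \<le> pi / 2" "G a = 0" "G b = 0"
    "\<And>y. y \<in> {a<..<b} \<Longrightarrow> G y \<noteq> 0"
proof -
  define \<tau> where "\<tau> = 2 * pi / real m"
  have \<tau>: "\<tau> > 0" "\<tau> \<le> pi / 2" using m by (auto simp: \<tau>_def field_simps)
  have per: "G (y + of_int k * \<tau>) = G y" for y k
    by (rule periodic_int_multiple) (use G_sym in \<open>simp add: \<tau>_def\<close>)
  have clZ: "closed {y. G y = 0}" by (intro closed_Collect_eq continuous_G continuous_intros)
  define A where "A = {y. G y = 0} \<inter> {..x}"
  define C where "C = {y. G y = 0} \<inter> {x..}"
  \<comment> \<open>The translates of \<open>z\<close> by \<open>k\<close> and by
    \<open>k - 1\<close> periods lie on the two sides of \<open>x\<close>, so both sets of zeros are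
    nonempty.\<close>
  obtain k :: int where k: "(z - x) + of_int k * \<tau> \<in> {0..<\<tau>}"
    using ex_int_translate_into_period[OF \<tau>(1)] .
  have "z + of_int k * \<tau> \<in> C" using k z per by (simp add: C_def)
  moreover have "z + of_int (k - 1) * \<tau> \<in> A" using k z per[of z "k - 1"] by (simp add: A_def algebra_simps)
  moreover have A: "closed A" "bdd_above A" and C: "closed C" "bdd_below C"
    by (auto simp: A_def C_def intro!: closed_Int clZ bdd_aboveI[of _ x] bdd_belowI[of _ x])
  ultimately have inA: "Sup A \<in> A" and inC: "Inf C \<in> C"
    by (auto intro!: closed_contains_Sup closed_contains_Inf)
  show thesis
  proof (rule that)
    show "G (Sup A) = 0" "G (Inf C) = 0" using inA inC by (auto simp: A_def C_def)
    show ltA: "Sup A < x" using inA x by (auto simp: A_def less_le)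
    show "x < Inf C" using inC x by (auto simp: C_def less_le)
    show "G y \<noteq> 0" if y: "y \<in> {Sup A<..<Inf C}" for y
    proof
      assume "G y = 0"
      then have "y \<in> A \<or> y \<in> C" by (auto simp: A_def C_def)
      then show False using cSup_upper[OF _ A(2)] cInf_lower[OF _ C(2)] y by force
    qed
    have zero: "G (Sup A + \<tau>) = 0" using per[of "Sup A" 1] inA by (simp add: A_def)
    have "\<not> Sup A + \<tau> \<le> x"
      using cSup_upper[OF _ A(2), of "Sup A + \<tau>"] zero \<tau>(1) by (auto simp: A_def)
    then have "Sup A + \<tau> \<in> C" using zero by (simp add: C_def)
    then show "Inf C - Sup A \<le> pi / 2" using cInf_lower[OF _ C(2), of "Sup A + \<tau>"] \<tau>(2) by linarith
  qed
qed

text \<open>\<open>G\<close> keeps one sign between consecutive zeros, which fixes the signs of its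
  slopes at both ends; the slope at \<open>b\<close> then determines the sign of \<open>c\<close>
  through \<open>forced_oscillator_sign\<close>. The slope at \<open>a\<close> serves to find both
  extreme values of \<open>H\<close>.\<close>

lemma nodal_signs:
  assumes z: "G z = 0" and x: "G x \<noteq> 0"
  obtains a b c where "G a = 0" "G b = 0" "Q x - E = 2 * c * G x"
    "G x > 0 \<Longrightarrow> H a \<ge> 0 \<and> H b \<le> 0 \<and> c \<le> 0"
    "G x < 0 \<Longrightarrow> H a \<le> 0 \<and> H b \<ge> 0 \<and> c \<ge> 0"
proof -
  obtain a b where ab: "a < x" "x < b" "b - a \<le> pi / 2" "G a = 0" "G b = 0"
    and nz: "\<And>y. y \<in> {a<..<b} \<Longrightarrow> G y \<noteq> 0"
    using nodal_interval[OF z x] by metis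
  obtain c where c: "\<And>y. y \<in> {a<..<b} \<Longrightarrow> Q y - E = 2 * c * G y"
    "\<And>y. y \<in> {a<..<b} \<Longrightarrow> (H has_real_derivative c - 4 * G y) (at y)"
    by (rule const_on_nonzero[OF open_greaterThanLessThan connected_Ioo nz]) auto
  have sgn: "(0 < G y) = (0 < G x)" if y: "y \<in> {a<..<b}" for y
  proof (rule ccontr)
    assume ne: "(0 < G y) \<noteq> (0 < G x)"
    have "connected (G ` {a<..<b})" by (intro connected_continuous_image continuous_G connected_Ioo)
    moreover have "G x \<in> G ` {a<..<b}" "G y \<in> G ` {a<..<b}" using ab y by auto
    ultimately have "0 \<in> G ` {a<..<b}"
      using ne nz[OF y] x unfolding connected_iff_interval by (metis linorder_not_less order_less_imp_le)
    then show False using nz by force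
  qed
  note osc = forced_oscillator_sign[OF _ ab(3) continuous_G continuous_H has_derivative_G c(2) ab(4,5)]
  have alb: "a < b" using ab by simp
  show thesis
  proof (rule that[OF ab(4,5) c(1)])
    show "x \<in> {a<..<b}" using ab by simp
    show "H a \<ge> 0 \<and> H b \<le> 0 \<and> c \<le> 0" if "G x > 0"
    proof -
      have "G y > 0" if "y \<in> {a<..<b}" for y using sgn[OF that] \<open>G x > 0\<close> by simp
      then have "H a \<ge> 0" "H b \<le> 0"
        using nonneg_derivative_at_left_end[OF has_derivative_G alb] nonpos_derivative_at_right_end[OF has_derivative_G alb]
          ab(4,5) by (metis less_imp_le)+
      then show ?thesis using osc(1) alb by auto
    qed
    show "H a \<le> 0 \<and> H b \<ge> 0 \<and> c \<ge> 0" if "G x < 0"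
    proof -
      have neg: "- G y \<ge> 0" if "y \<in> {a<..<b}" for y using sgn[OF that] \<open>G x < 0\<close> by simp
      have d: "((\<lambda>x. - G x) has_real_derivative - H y) (at y)" for y
        by (intro DERIV_minus has_derivative_G)
      have "- H a \<ge> 0" "- H b \<le> 0"
        using nonneg_derivative_at_left_end[OF d alb] nonpos_derivative_at_right_end[OF d alb]
          ab(4,5) neg by auto
      then show ?thesis using osc(2) alb by auto
    qed
  qed
qed

lemma Q_le_energy:
  assumes z: "G z = 0"
  shows "Q x \<le> E"
proof (cases "G x = 0")
  case True
  then show ?thesis using Q_at_zero by simp
next
  case False
  obtain c where c: "Q x - E = 2 * c * G x" "G x > 0 \<Longrightarrow> c \<le> 0" "G x < 0 \<Longrightarrow> c \<ge> 0"
    using nodal_signs[OF z False] by metis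
  have "c * G x \<le> 0" using c(2,3) False by (cases "G x > 0") (auto simp: mult_le_0_iff)
  then show ?thesis using c(1) by simp
qed

text \<open>At a zero the square of \<open>H\<close> is \<open>E > 0\<close>, so every zero is
  simple. An accumulation point of zeros would itself be a zero, with difference quotients vanishing
  along the zeros but tending to \<open>H y \<noteq> 0\<close>.\<close>

lemma finite_zeros:
  assumes "E > 0"
  shows "finite {x \<in> {a..b}. G x = 0}"
proof (rule ccontr)
  assume "infinite {x \<in> {a..b}. G x = 0}"
  then obtain y where y: "y islimpt {x \<in> {a..b}. G x = 0}"
    using Heine_Borel_imp_Bolzano_Weierstrass[OF compact_Icc[of a b], of "{x \<in> {a..b}. G x = 0}"] by blast
  then have lp: "y islimpt {x. G x = 0}" by (rule islimpt_subset) auto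
  have "closed {x. G x = 0}" by (intro closed_Collect_eq continuous_G continuous_intros)
  then have Gy: "G y = 0" using lp by (auto simp: closed_limpt)
  have "((\<lambda>t. (G t - G y) / (t - y)) \<longlongrightarrow> H y) (at y)"
    using has_derivative_G[of y] by (simp add: has_field_derivative_iff)
  moreover have "H y \<noteq> 0" using Q_at_zero[OF Gy] Gy assms by (auto simp: Q_def)
  ultimately have "eventually (\<lambda>t. (G t - G y) / (t - y) \<noteq> 0) (at y)"
    by (rule tendsto_imp_eventually_ne)
  then have "eventually (\<lambda>t. G t \<noteq> 0) (at y)" by eventually_elim (use Gy in auto)
  then show False using lp by (auto simp: islimpt_iff_eventually)
qed

text \<open>A zero whose representative in \<open>{0..<2 * pi}\<close> is not a jump has, by the
  very form of the excluded set, a neighborhood of that representative on which \<open>g\<close> is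
  almost everywhere constant; periodicity moves it back to \<open>x\<close>.\<close>

lemma locally_const_off_jumps:
  assumes "\<And>k::int. x + of_int k * (2 * pi) \<notin>
      {\<theta> \<in> {0..<2 * pi}. G \<theta> = 0 \<and> (\<forall>\<epsilon>>0. \<not> ae_const_on g (\<theta> - \<epsilon>) (\<theta> + \<epsilon>))}"
  shows "\<exists>e>0. \<exists>c. AE y in lborel. y \<in> ball x e \<longrightarrow> g y = c"
proof (cases "G x = 0")
  case False
  have "open {y. G y \<noteq> 0}" by (intro open_Collect_neq continuous_G continuous_intros)
  then obtain e where e: "e > 0" "ball x e \<subseteq> {y. G y \<noteq> 0}" 
    by (rule openE) (use False in auto)
  obtain c where "AE y in lborel. y \<in> ball x e \<longrightarrow> g y = c"
    by (rule const_on_nonzero[OF open_ball connected_ball[of x e]]) (use e(2) in auto)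
  then show ?thesis using e(1) by blast
next
  case True
  obtain k :: int where k: "x + of_int k * (2 * pi) \<in> {0..<2 * pi}"
    using ex_int_translate_into_period[of "2 * pi" x] by auto
  define \<theta> where "\<theta> = x + of_int k * (2 * pi)"
  have "G \<theta> = 0" using True unfolding \<theta>_def by (simp only: G_periodic)
  then obtain \<epsilon> where \<epsilon>: "\<epsilon> > 0" "ae_const_on g (\<theta> - \<epsilon>) (\<theta> + \<epsilon>)"
    using assms[of k] k unfolding \<theta>_def[symmetric] by blast
  then obtain c where c: "AE y in lborel. y \<in> {\<theta> - \<epsilon><..<\<theta> + \<epsilon>} \<longrightarrow> g y = c"
    by (auto simp: ae_const_on_def)
  have "AE y in lborel. of_int k * (2 * pi) + y \<in> {\<theta> - \<epsilon><..<\<theta> + \<epsilon>} \<longrightarrow> g (of_int k * (2 * pi) + y) = c"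
    by (rule AE_lborel_shift[OF _ c]) measurable
  then have "AE y in lborel. y \<in> ball x \<epsilon> \<longrightarrow> g y = c"
  proof eventually_elim
    case (elim y)
    then show ?case using g_periodic[of y k]
      by (auto simp: \<theta>_def ball_eq_greaterThanLessThan add.commute)
  qed
  then show ?thesis using \<epsilon>(1) by blast
qed

text \<open>If \<open>G\<close> vanishes identically, the integrated equation makes every interval
  integral of \<open>g\<close> zero. Otherwise \<open>0 < Q x \<le> E\<close> at any
  \<open>x\<close> with \<open>G x \<noteq> 0\<close>.\<close>

lemma zero_dichotomy:
  assumes z: "G z = 0"
  shows "(\<exists>c. AE x in lborel. g x = c) \<or> E > 0 \<and> (\<exists>x. G x \<noteq> 0)"
proof (cases "\<exists>x. G x \<noteq> 0")
  case True
  then obtain x where "G x \<noteq> 0" by blast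
  then have "0 < Q x" by (simp add: Q_def add_nonneg_pos)
  then show ?thesis using Q_le_energy[OF z, of x] True by simp
next
  case False
  then have G0: "G = (\<lambda>x. 0)" by auto
  then have H0: "H = (\<lambda>x. 0)" by (intro ext) simp
  obtain B where B: "\<And>x. \<bar>g x\<bar> \<le> B" using g_bound by blast
  have "AE x in lborel. g x = 0"
  proof (rule AE_zero_of_interval_integrals[OF g_borel B])
    fix a b :: real assume "a \<le> b"
    from H_has_integral[OF this] have "(g has_integral 0) {a..b}" using G0 H0 by simp
    then show "integral {a..b} g = 0" by (rule integral_unique)
  qed
  then show ?thesis by blast
qed

lemma abs_H_at_zero:
  assumes "G x = 0"
  shows "\<bar>H x\<bar> = sqrt E"
proof -
  have "E = (H x)\<^sup>2" using Q_at_zero[OF assms] assms by (simp add: Q_def)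
  then show ?thesis by simp
qed

lemma both_extrema_attained:
  assumes z: "G z = 0" and x: "G x \<noteq> 0"
  shows "\<exists>y. H y = sqrt E" "\<exists>y. H y = - sqrt E"
proof -
  obtain a b where ab: "G a = 0" "G b = 0"
    "G x > 0 \<Longrightarrow> H a \<ge> 0 \<and> H b \<le> 0" "G x < 0 \<Longrightarrow> H a \<le> 0 \<and> H b \<ge> 0"
    using nodal_signs[OF z x] by metis
  have "\<bar>H a\<bar> = sqrt E" "\<bar>H b\<bar> = sqrt E" using ab abs_H_at_zero by auto
  moreover have "H a \<ge> 0 \<and> H b \<le> 0 \<or> H a \<le> 0 \<and> H b \<ge> 0" using ab(3,4) x by linarith
  ultimately have "H a = sqrt E \<and> H b = - sqrt E \<or> H b = sqrt E \<and> H a = - sqrt E" by linarith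
  then show "\<exists>y. H y = sqrt E" "\<exists>y. H y = - sqrt E" by auto
qed

end

theorem mainTheorem4:
  fixes m :: nat and g G :: "real \<Rightarrow> real"
  assumes m: "m \<ge> 4"
    and g_meas: "g \<in> borel_measurable lborel"
    and g_bdd: "bounded (range g)"
    and g_sym: "\<forall>x. g (x + 2 * pi / real m) = g x"
    and G_sym: "\<forall>x. G (x + 2 * pi / real m) = G x"
    and G_diff: "\<forall>x. G differentiable (at x)"
    and G_eq: "\<forall>a b. a \<le> b \<longrightarrow>
                 deriv G b - deriv G a = integral {a..b} (\<lambda>x. g x - 4 * G x)"
    and steady: "\<forall>\<phi>. smooth_periodic \<phi> \<longrightarrow>
                 integral {0..2 * pi} (\<lambda>x. G x * g x * deriv \<phi> x + deriv G x * g x * \<phi> x) = 0"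
  shows "(\<exists>c. AE x in lborel. g x = c) \<or>
         (\<exists>J M. finite J \<and> J \<noteq> {} \<and> J \<subseteq> {0..<2 * pi} \<and>
            (\<forall>a b. a < b \<and> {a<..<b} \<inter> {\<theta> + 2 * pi * of_int k | \<theta> k. \<theta> \<in> J} = {}
                    \<longrightarrow> ae_const_on g a b) \<and>
            (\<forall>\<theta>\<in>J. \<forall>\<epsilon>>0. \<not> ae_const_on g (\<theta> - \<epsilon>) (\<theta> + \<epsilon>)) \<and>
            M > 0 \<and> (\<forall>x. - M \<le> deriv G x \<and> deriv G x \<le> M) \<and>
            (\<exists>x. deriv G x = M) \<and> (\<exists>x. deriv G x = - M) \<and>
            (\<forall>\<theta>\<in>J. deriv G \<theta> = M \<or> deriv G \<theta> = - M))"
proof -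
  interpret steady_solution m g G by unfold_locales (fact assms)+
  obtain E where "AE x in lborel. 2 * G x * g x = Q x - E" using first_integral by blast
  then interpret steady_energy m g G E by unfold_locales
  \<comment> \<open>Keeping only zeros around which \<open>g\<close> is not constant makes the
    non-constancy at the jumps true by definition; what remains to prove is constancy off the
    translates of \<open>J\<close>.\<close>
  define J where "J = {\<theta> \<in> {0..<2 * pi}. G \<theta> = 0 \<and> (\<forall>\<epsilon>>0. \<not> ae_const_on g (\<theta> - \<epsilon>) (\<theta> + \<epsilon>))}"
  show ?thesis
  proof (cases "(\<exists>c. AE x in lborel. g x = c)")
    case False
    have const: "\<exists>c. AE x in lborel. x \<in> S \<longrightarrow> g x = c"
      if S: "open S" "connected S" "S \<inter> {\<theta> + 2 * pi * of_int k | \<theta> k. \<theta> \<in> J} = {}" for S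
    proof (rule AE_const_of_locally_AE_const[OF S(1,2)])
      fix x assume x: "x \<in> S"
      have "x + of_int k * (2 * pi) \<notin> J" for k :: int
      proof
        assume "x + of_int k * (2 * pi) \<in> J"
        moreover have "x = (x + of_int k * (2 * pi)) + 2 * pi * of_int (- k)" by simp
        ultimately have "x \<in> {\<theta> + 2 * pi * of_int k | \<theta> k. \<theta> \<in> J}" by blast
        then show False using S(3) x by blast
      qed
      then show "\<exists>e>0. \<exists>c. AE y in lborel. y \<in> ball x e \<longrightarrow> g y = c"
        unfolding J_def by (rule locally_const_off_jumps)
    qed
    \<comment> \<open>With no jumps, \<open>const\<close> applies to the whole line and contradicts
      the non-constancy of \<open>g\<close>. Any element of \<open>J\<close> then supplies the zero
      of \<open>G\<close> on which the energy bound rests.\<close>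
    have "J \<noteq> {}"
    proof
      assume "J = {}"
      then show False using const[of UNIV] False by simp
    qed
    then obtain z where z: "G z = 0" by (auto simp: J_def)
    obtain x where E: "E > 0" and x: "G x \<noteq> 0" using zero_dichotomy[OF z] False by blast
    have "finite J" by (rule finite_subset[OF _ finite_zeros[OF E, of 0 "2 * pi"]]) (auto simp: J_def)
    moreover have "ae_const_on g a b"
      if "a < b \<and> {a<..<b} \<inter> {\<theta> + 2 * pi * of_int k | \<theta> k. \<theta> \<in> J} = {}" for a b
      unfolding ae_const_on_def using that by (intro const) auto
    moreover have "\<bar>deriv G y\<bar> \<le> sqrt E" for y
    proof -
      have "(deriv G y)\<^sup>2 \<le> E" 
        using Q_le_energy[OF z, of y] zero_le_power2[of "G y"] unfolding Q_def by linarith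
      then show ?thesis using real_le_rsqrt[of "\<bar>deriv G y\<bar>" E] by simp
    qed
    then have "- sqrt E \<le> deriv G y \<and> deriv G y \<le> sqrt E" for y by (simp add: abs_le_iff minus_le_iff)
    moreover have "deriv G \<theta> = sqrt E \<or> deriv G \<theta> = - sqrt E" if "\<theta> \<in> J" for \<theta>
    proof -
      have "\<bar>deriv G \<theta>\<bar> = sqrt E" using that by (intro abs_H_at_zero) (simp add: J_def)
      then show ?thesis by linarith
    qed
    moreover have "J \<subseteq> {0..<2 * pi}" "\<forall>\<theta>\<in>J. \<forall>\<epsilon>>0. \<not> ae_const_on g (\<theta> - \<epsilon>) (\<theta> + \<epsilon>)"
      by (auto simp: J_def)
    ultimately show ?thesis
      using \<open>J \<noteq> {}\<close> E both_extrema_attained[OF z x]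
      by (intro disjI2 exI[of _ J] exI[of _ "sqrt E"]) auto
  qed simp
qed

end
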